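(* Let $\mathcal{F}$ be a $(p)$-filter on $E$. Then $\mathcal{F}$ is $+$-strategic if and only if $\mathcal{F}$ is strategic and full.
   Context: $E$ is a countably infinite-dimensional vector space over a countable field $F$ with fixed basis $(e_n)$; $\mathrm{supp}(v)$ for nonzero $v$ is the set of $i$ with $e_i$ having nonzero coefficient in $v$. A block sequence is a sequence $(x_n)$ of nonzero vectors with $\max\mathrm{supp}(x_n)<\min\mathrm{supp}(x_{n+1})$; $E^{[\infty]}$ the set of infinite block sequences; $\langle X\rangle$ the span minus $0$; $Y\preceq X$ iff $\langle Y\rangle\subseteq\langle X\rangle$; $X/n$ the tail of vectors with support above $n$; $Y\preceq^*X$ iff $Y/n\preceq X$ for some $n$. A filter on $E$ is a proper filter of subsets of $E\setminus\{0\}$ containing nonzero parts of all finite-codimensional subspaces; a block filter has a base of sets $\langle X\rangle$, $X\in E^{[\infty]}$. For a block filter $\mathcal{F}$: $D\subseteq E$ is $\mathcal{F}$-dense if for every $\langle X\rangle\in\mathcal{F}$ there is an infinite-dimensional subspace $V\subseteq\langle X\rangle\cup\{0\}$ with $V\setminus\{0\}\subseteq D$; full: every $\mathcal{F}$-dense set is in $\mathcal{F}$; $(p)$-filter: a block filter such that whenever $\langle X_n\rangle\in\mathcal{F}$ for all $n$ there is $\langle X\rangle\in\mathcal{F}$ with $X\preceq^* X_n$ for all $n$. Gowers game $G[X]$: I and II alternate, I first; I plays $Y_k\in E^{[\infty]}$ with $Y_k\preceq X$, II responds with $y_k\in\langle Y_k\rangle$ so that $(y_k)$ is a block sequence; the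 outcome is $(y_k)$. The restricted Gowers game $G_{\mathcal{F}}[X]$ is the same except I must play $Y_k$ with $\langle Y_k\rangle\in\mathcal{F}$. $\mathcal{F}$ is strategic if whenever $\langle X\rangle\in\mathcal{F}$ and $\alpha$ is a strategy for II in $G[X]$, some outcome $Y$ of $\alpha$ has $\langle Y\rangle\in\mathcal{F}$; $\mathcal{F}$ is $+$-strategic if whenever $\langle X\rangle\in\mathcal{F}$ and $\alpha$ is a strategy for II in $G_{\mathcal{F}}[X]$, some outcome $Y$ of $\alpha$ has $\langle Y\rangle\in\mathcal{F}$. *)

theory Defs
  imports Complex_Main "HOL-Library.Countable"
begin

locale block_space = vector_space scale
  for scale :: "'f::{field,countable} \<Rightarrow> 'v::ab_group_add \<Rightarrow> 'v" (infixr \<open>*s\<close> 75) +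
  fixes e :: "nat \<Rightarrow> 'v"
  assumes basis_inj: "inj e"
    and basis_independent: "independent (range e)"
    and basis_span: "span (range e) = UNIV"
begin

definition supp :: "'v \<Rightarrow> nat set" where
  "supp v = {i. representation (range e) v (e i) \<noteq> 0}"

definition block_before :: "'v \<Rightarrow> 'v \<Rightarrow> bool" where
  "block_before x y \<longleftrightarrow> Max (supp x) < Min (supp y)"

definition block_seq :: "(nat \<Rightarrow> 'v) \<Rightarrow> bool" where
  "block_seq X \<longleftrightarrow> (\<forall>n. X n \<noteq> 0) \<and> (\<forall>n. block_before (X n) (X (Suc n)))"

definition bspan :: "(nat \<Rightarrow> 'v) \<Rightarrow> 'v set" where
  "bspan X = span (range X) - {0}"

definition block_le :: "(nat \<Rightarrow> 'v) \<Rightarrow> (nat \<Rightarrow> 'v) \<Rightarrow> bool" where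
  "block_le Y X \<longleftrightarrow> bspan Y \<subseteq> bspan X"

text \<open>The supports of a block sequence increase, so its vectors with support entirely
  above \<open>n\<close> are exactly those from the first such vector on.\<close>

definition block_tail :: "(nat \<Rightarrow> 'v) \<Rightarrow> nat \<Rightarrow> nat \<Rightarrow> 'v" where
  "block_tail X n = (\<lambda>k. X ((LEAST m. n < Min (supp (X m))) + k))"

definition block_le_star :: "(nat \<Rightarrow> 'v) \<Rightarrow> (nat \<Rightarrow> 'v) \<Rightarrow> bool" where
  "block_le_star Y X \<longleftrightarrow> (\<exists>n. block_le (block_tail Y n) X)"

definition finite_codim_subspace :: "'v set \<Rightarrow> bool" where
  "finite_codim_subspace V \<longleftrightarrow> subspace V \<and> (\<exists>B. finite B \<and> span (V \<union> B) = UNIV)"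

definition infinite_dim_subspace :: "'v set \<Rightarrow> bool" where
  "infinite_dim_subspace V \<longleftrightarrow> subspace V \<and> \<not> (\<exists>B. finite B \<and> span B = V)"

definition filter_on_E :: "'v set set \<Rightarrow> bool" where
  "filter_on_E \<F> \<longleftrightarrow>
     (\<forall>A\<in>\<F>. A \<subseteq> UNIV - {0}) \<and>
     UNIV - {0} \<in> \<F> \<and>
     {} \<notin> \<F> \<and>
     (\<forall>A\<in>\<F>. \<forall>B\<in>\<F>. A \<inter> B \<in> \<F>) \<and>
     (\<forall>A\<in>\<F>. \<forall>B. A \<subseteq> B \<and> B \<subseteq> UNIV - {0} \<longrightarrow> B \<in> \<F>) \<and>
     (\<forall>V. finite_codim_subspace V \<longrightarrow> V - {0} \<in> \<F>)"

definition block_filter :: "'v set set \<Rightarrow> bool" where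
  "block_filter \<F> \<longleftrightarrow> filter_on_E \<F> \<and>
     (\<forall>A\<in>\<F>. \<exists>X. block_seq X \<and> bspan X \<in> \<F> \<and> bspan X \<subseteq> A)"

definition filter_dense :: "'v set set \<Rightarrow> 'v set \<Rightarrow> bool" where
  "filter_dense \<F> D \<longleftrightarrow>
     (\<forall>X. block_seq X \<and> bspan X \<in> \<F> \<longrightarrow>
       (\<exists>V. infinite_dim_subspace V \<and> V \<subseteq> bspan X \<union> {0} \<and> V - {0} \<subseteq> D))"

text \<open>Members of a filter never contain \<open>0\<close>, while a dense set may; density does not
  depend on whether it does, so \<open>0\<close> is discarded.\<close>

definition full :: "'v set set \<Rightarrow> bool" where
  "full \<F> \<longleftrightarrow> (\<forall>D. filter_dense \<F> D \<longrightarrow> D - {0} \<in> \<F>)"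

definition p_filter :: "'v set set \<Rightarrow> bool" where
  "p_filter \<F> \<longleftrightarrow> block_filter \<F> \<and>
     (\<forall>Xs :: nat \<Rightarrow> nat \<Rightarrow> 'v. (\<forall>n. block_seq (Xs n) \<and> bspan (Xs n) \<in> \<F>) \<longrightarrow>
       (\<exists>X. block_seq X \<and> bspan X \<in> \<F> \<and> (\<forall>n. block_le_star X (Xs n))))"

definition gowers_moves :: "(nat \<Rightarrow> 'v) \<Rightarrow> (nat \<Rightarrow> 'v) set" where
  "gowers_moves X = {Y. block_seq Y \<and> block_le Y X}"

definition restricted_gowers_moves :: "'v set set \<Rightarrow> (nat \<Rightarrow> 'v) \<Rightarrow> (nat \<Rightarrow> 'v) set" where
  "restricted_gowers_moves \<F> X = {Y \<in> gowers_moves X. bspan Y \<in> \<F>}"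

text \<open>A strategy for II, in the game where I may play the members of \<open>M\<close>, maps each finite
  sequence \<open>Y\<^sub>0, \<dots>, Y\<^sub>k\<close> of moves of I to the response \<open>y\<^sub>k\<close> of II. The earlier
  responses of II are the values of the strategy at the proper nonempty initial segments.\<close>

definition strategy_II :: "(nat \<Rightarrow> 'v) set \<Rightarrow> ((nat \<Rightarrow> 'v) list \<Rightarrow> 'v) \<Rightarrow> bool" where
  "strategy_II M \<alpha> \<longleftrightarrow>
     (\<forall>Ys Y. set Ys \<subseteq> M \<and> Y \<in> M \<longrightarrow>
       \<alpha> (Ys @ [Y]) \<in> bspan Y \<and>
       (Ys \<noteq> [] \<longrightarrow> block_before (\<alpha> Ys) (\<alpha> (Ys @ [Y]))))"

definition outcome_of ::
    "(nat \<Rightarrow> 'v) set \<Rightarrow> ((nat \<Rightarrow> 'v) list \<Rightarrow> 'v) \<Rightarrow> (nat \<Rightarrow> 'v) \<Rightarrow> bool" where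
  "outcome_of M \<alpha> y \<longleftrightarrow>
     (\<exists>Y :: nat \<Rightarrow> nat \<Rightarrow> 'v. (\<forall>k. Y k \<in> M) \<and> (\<forall>k. y k = \<alpha> (map Y [0..<Suc k])))"

definition strategic :: "'v set set \<Rightarrow> bool" where
  "strategic \<F> \<longleftrightarrow>
     (\<forall>X \<alpha>. block_seq X \<and> bspan X \<in> \<F> \<and> strategy_II (gowers_moves X) \<alpha> \<longrightarrow>
       (\<exists>Y. outcome_of (gowers_moves X) \<alpha> Y \<and> bspan Y \<in> \<F>))"

definition plus_strategic :: "'v set set \<Rightarrow> bool" where
  "plus_strategic \<F> \<longleftrightarrow>
     (\<forall>X \<alpha>. block_seq X \<and> bspan X \<in> \<F> \<and> strategy_II (restricted_gowers_moves \<F> X) \<alpha> \<longrightarrow>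
       (\<exists>Y. outcome_of (restricted_gowers_moves \<F> X) \<alpha> Y \<and> bspan Y \<in> \<F>))"

end

end

theory Submission
  imports Defs "HOL-Library.Countable_Set"
begin

text \<open>Write \<open>V \<subseteq>\<^sup>* X\<close> if all vectors of \<open>V\<close> with sufficiently high support lie in \<open>\<langle>X\<rangle>\<close>.

  A strategy in the unrestricted game restricts to the restricted one, so \<open>+\<close>-strategic filters
  are strategic. For fullness, let \<open>D\<close> be dense and call a finite sequence \<open>s\<close> \<^emph>\<open>alive\<close>
  if for every \<open>\<langle>X\<rangle> \<in> \<F>\<close> some infinite-dimensional \<open>V \<subseteq>\<^sup>* X\<close> contains \<open>s\<close> and satisfies
  \<open>V - {0} \<subseteq> D\<close>. The empty sequence is alive, and an alive sequence can be prolonged to an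
  alive one inside any \<open>\<langle>Y\<rangle> \<in> \<F>\<close>: otherwise diagonalise the countably many witnesses of failure
  by the (p)-property. Hence II can play so as to remain alive, and every outcome of that
  strategy spans a subset of \<open>D\<close>.

  Conversely let \<open>\<alpha>\<close> be a strategy for II in the restricted game. After a history \<open>h\<close>,
  the set of possible answers of \<open>\<alpha>\<close> meets every member of \<open>\<F>\<close>, so its complement is not dense
  by fullness; thus below some \<open>\<langle>Z\<^sub>h\<rangle> \<in> \<F>\<close> it meets every infinite-dimensional subspace. Fixing one
  history for each of the countably many sequences of answers and diagonalising the \<open>Z\<^sub>h\<close>, II can
  imitate \<open>\<alpha>\<close> in the unrestricted game.\<close>

context block_space
begin

section \<open>Countability, supports and spans of block sequences\<close>

lemma in_span_basis [simp]: "v \<in> span (range e)"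
  by (simp add: basis_span)

lemma span_range_initial:
  assumes "v \<in> span (range f)"
  obtains n :: nat where "v \<in> span (f ` {..<n})"
proof -
  obtain t r where t: "finite t" "t \<subseteq> range f" and v: "v = (\<Sum>a\<in>t. r a *s a)"
    using assms unfolding span_explicit by blast
  obtain I where I: "finite I" "t = f ` I" using t by (meson finite_subset_image)
  then obtain n where "I \<subseteq> {..<n}" by (meson finite_nat_iff_bounded)
  then have "t \<subseteq> f ` {..<n}" using I by blast
  then have "v \<in> span (f ` {..<n})"
    unfolding v by (intro span_sum span_scale span_base) auto
  then show ?thesis by (rule that)
qed

text \<open>The scalars are countable, so by induction each span of an initial part of the basis is
  countable, and these spans exhaust the space. This allows the (p)-property to handle all vectors,
  or all finite lists of vectors, at once.\<close>

lemma countable_vectors: "countable (UNIV :: 'v set)"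
proof -
  have cnt: "countable (span (e ` {..<n}))" for n
  proof (induction n)
    case 0
    then show ?case by simp
  next
    case (Suc n)
    have "span (e ` {..<Suc n}) \<subseteq> (\<lambda>(k, v). k *s e n + v) ` (UNIV \<times> span (e ` {..<n}))"
    proof
      fix x assume "x \<in> span (e ` {..<Suc n})"
      then obtain k where "x - k *s e n \<in> span (e ` {..<n})"
        by (auto simp: lessThan_Suc span_insert)
      moreover have "x = k *s e n + (x - k *s e n)" by simp
      ultimately show "x \<in> (\<lambda>(k, v). k *s e n + v) ` (UNIV \<times> span (e ` {..<n}))"
        by (intro image_eqI[where x = "(k, x - k *s e n)"]) auto
    qed
    then show ?case
      by (rule countable_subset) (use Suc in \<open>intro countable_image countable_SIGMA\<close>, auto)
  qed
  have "UNIV \<subseteq> (\<Union>n. span (e ` {..<n}))"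
  proof
    fix v :: 'v
    show "v \<in> (\<Union>n. span (e ` {..<n}))"
      using span_range_initial[OF in_span_basis[of v]] by blast
  qed
  then show ?thesis
    by (rule countable_subset) (use cnt in auto)
qed

lemma finite_supp [simp]: "finite (supp v)"
proof -
  have "e ` supp v \<subseteq> {b. representation (range e) v b \<noteq> 0}"
    by (auto simp: supp_def)
  then have "finite (e ` supp v)"
    using finite_representation finite_subset by blast
  then show ?thesis
    using basis_inj by (meson finite_imageD inj_on_subset subset_UNIV)
qed

lemma supp_empty_iff [simp]: "supp v = {} \<longleftrightarrow> v = 0"
proof
  assume "supp v = {}"
  then have "representation (range e) v b = 0" for b
    using representation_ne_zero[of "range e" v b] unfolding supp_def by blast
  then show "v = 0"
    using sum_nonzero_representation_eq[OF basis_independent in_span_basis, of v] by simp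
qed (simp add: supp_def representation_zero)

lemma Min_supp_gt: "v \<noteq> 0 \<Longrightarrow> supp v \<subseteq> {n<..} \<Longrightarrow> n < Min (supp v)"
  using Min_in[of "supp v"] by auto

lemma Min_supp_le_Max: "v \<noteq> 0 \<Longrightarrow> Min (supp v) \<le> Max (supp v)"
  by simp

lemma subspace_supp_subset: "subspace {v. supp v \<subseteq> S}"
  unfolding subspace_def supp_def
  by (auto simp: representation_zero basis_independent subset_iff
      representation_add[OF basis_independent in_span_basis in_span_basis]
      representation_scale[OF basis_independent in_span_basis])
    (metis add_0)

lemma supp_span_subset: "v \<in> span A \<Longrightarrow> (\<And>a. a \<in> A \<Longrightarrow> supp a \<subseteq> S) \<Longrightarrow> supp v \<subseteq> S"
  using span_minimal[OF _ subspace_supp_subset, of A S] by blast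

lemma block_seq_Max_less_Min:
  assumes "block_seq X" "i < j"
  shows "Max (supp (X i)) < Min (supp (X j))"
  using assms(2)
proof (induction j)
  case (Suc j)
  have step: "Max (supp (X j)) < Min (supp (X (Suc j)))" and nz: "X j \<noteq> 0"
    using assms(1) by (auto simp: block_seq_def block_before_def)
  have "Min (supp (X j)) \<le> Max (supp (X j))"
    using nz by (rule Min_supp_le_Max)
  then show ?case
    using Suc step by (cases "i = j") auto
qed simp

lemma block_seq_Min_ge:
  assumes "block_seq X"
  shows "n \<le> Min (supp (X n))"
proof (induction n)
  case (Suc n)
  have "Min (supp (X n)) \<le> Max (supp (X n))"
    using assms by (intro Min_supp_le_Max) (auto simp: block_seq_def)
  with Suc block_seq_Max_less_Min[OF assms, of n "Suc n"] show ?case by simp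
qed simp

text \<open>Peel off the last vector \<open>X m\<close>: at its least support index \<open>j\<close>
  all earlier vectors vanish, and so does \<open>a\<close> since \<open>j \<le> n\<close>. Hence the
  coefficient of \<open>X m\<close> in \<open>a\<close> is zero.\<close>

lemma span_block_initial_eq_0:
  assumes X: "block_seq X"
  shows "(\<And>i. i < m \<Longrightarrow> Min (supp (X i)) \<le> n) \<Longrightarrow> a \<in> span (X ` {..<m}) \<Longrightarrow>
    supp a \<subseteq> {n<..} \<Longrightarrow> a = 0"
proof (induction m arbitrary: a)
  case 0
  then show ?case by simp
next
  case (Suc m)
  define j where "j = Min (supp (X m))"
  have nz: "X m \<noteq> 0" using X by (simp add: block_seq_def)
  then have j: "j \<in> supp (X m)" by (simp add: j_def)
  have "j \<le> n" using Suc.prems(1)[of m] by (simp add: j_def)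
  then have aj: "representation (range e) a (e j) = 0"
    using Suc.prems(3) by (auto simp: supp_def)
  obtain k where k: "a - k *s X m \<in> span (X ` {..<m})"
    using Suc.prems(2) by (auto simp: lessThan_Suc span_insert)
  have "supp (a - k *s X m) \<subseteq> {..<j}"
  proof (rule supp_span_subset[OF k])
    fix x assume "x \<in> X ` {..<m}"
    then obtain i where i: "i < m" "x = X i" by auto
    show "supp x \<subseteq> {..<j}"
      using block_seq_Max_less_Min[OF X i(1)] Max_ge[OF finite_supp]
      unfolding i j_def by (meson lessThan_iff le_less_trans subsetI)
  qed
  then have "representation (range e) (a - k *s X m) (e j) = 0"
    by (auto simp: supp_def)
  then have "k * representation (range e) (X m) (e j) = 0"
    using aj by (simp add: representation_diff[OF basis_independent in_span_basis in_span_basis]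
        representation_scale[OF basis_independent in_span_basis])
  then have "k = 0" using j by (simp add: supp_def)
  then have "a \<in> span (X ` {..<m})" using k by simp
  then show ?case using Suc by simp
qed

text \<open>Split \<open>v\<close> into a head part \<open>a\<close> and a tail part
  \<open>b\<close>. Both \<open>v\<close> and \<open>b\<close> are supported above \<open>n\<close>,
  hence so is \<open>a\<close>, which forces \<open>a = 0\<close>. This turns tails of sequences
  into conditions on supports.\<close>

lemma in_span_block_tail:
  assumes X: "block_seq X" and v: "v \<in> span (range X)" "supp v \<subseteq> {n<..}"
  shows "v \<in> span (range (block_tail X n))"
proof -
  define N where "N = (LEAST m. n < Min (supp (X m)))"
  \<comment> \<open>Index \<open>Suc n\<close> shows that the \<open>LEAST\<close> in
    \<open>block_tail\<close> is attained.\<close>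
  have ex: "n < Min (supp (X (Suc n)))"
    using block_seq_Min_ge[OF X, of "Suc n"] by simp
  have N: "n < Min (supp (X N))"
    unfolding N_def by (rule LeastI[of _ "Suc n"]) (rule ex)
  have lt: "Min (supp (X i)) \<le> n" if "i < N" for i
    using not_less_Least[of i "\<lambda>m. n < Min (supp (X m))"] that by (simp add: N_def)
  have tail: "range (block_tail X n) = X ` {N..}"
  proof -
    have "range (block_tail X n) = X ` range (\<lambda>k. N + k)"
      by (auto simp: block_tail_def N_def)
    also have "range (\<lambda>k. N + k) = {N..}"
      by (auto simp: image_iff le_iff_add)
    finally show ?thesis .
  qed
  have "range X = X ` {..<N} \<union> X ` {N..}"
    by (auto simp flip: image_Un simp: not_less)
  then obtain a b where ab: "v = a + b" "a \<in> span (X ` {..<N})" "b \<in> span (X ` {N..})"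
    using v(1) by (auto simp: span_Un)
  have "supp b \<subseteq> {n<..}"
  proof (rule supp_span_subset[OF ab(3)])
    fix x assume "x \<in> X ` {N..}"
    then obtain i where i: "N \<le> i" "x = X i" by auto
    have "Min (supp (X N)) \<le> Min (supp (X i))"
    proof (cases "N = i")
      case False
      then have "Max (supp (X N)) < Min (supp (X i))"
        using block_seq_Max_less_Min[OF X] i by simp
      moreover have "Min (supp (X N)) \<le> Max (supp (X N))"
        using X by (intro Min_supp_le_Max) (auto simp: block_seq_def)
      ultimately show ?thesis by simp
    qed simp
    then show "supp x \<subseteq> {n<..}"
      using N Min_le[OF finite_supp, of _ x] unfolding i by (auto intro: less_le_trans)
  qed
  then have "v - b \<in> {v. supp v \<subseteq> {n<..}}"
    using v(2) subspace_diff[OF subspace_supp_subset] by blast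
  then have "supp a \<subseteq> {n<..}" using ab(1) by simp
  then have "a = 0" using span_block_initial_eq_0[OF X lt ab(2)] by blast
  then show ?thesis using ab tail by simp
qed

section \<open>Almost containment\<close>

text \<open>\<open>V\<close> is an arbitrary set, so that the relation applies to subspaces not
  given by a block sequence.\<close>

definition almost_in :: "'v set \<Rightarrow> (nat \<Rightarrow> 'v) \<Rightarrow> bool" where
  "almost_in V X \<longleftrightarrow> (\<exists>n. \<forall>v\<in>V. v \<noteq> 0 \<longrightarrow> supp v \<subseteq> {n<..} \<longrightarrow> v \<in> bspan X)"

lemma almost_in_subset: "almost_in V X \<Longrightarrow> W \<subseteq> V \<Longrightarrow> almost_in W X"
  unfolding almost_in_def by blast

lemma almost_in_trans: "almost_in V X \<Longrightarrow> almost_in (bspan X) Y \<Longrightarrow> almost_in V Y"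
proof -
  assume "almost_in V X" "almost_in (bspan X) Y"
  then obtain m n where m: "\<forall>v\<in>V. v \<noteq> 0 \<longrightarrow> supp v \<subseteq> {m<..} \<longrightarrow> v \<in> bspan X"
    and n: "\<forall>v\<in>bspan X. v \<noteq> 0 \<longrightarrow> supp v \<subseteq> {n<..} \<longrightarrow> v \<in> bspan Y"
    unfolding almost_in_def by blast
  have "\<forall>v\<in>V. v \<noteq> 0 \<longrightarrow> supp v \<subseteq> {max m n<..} \<longrightarrow> v \<in> bspan Y"
    using m n by fastforce
  then show ?thesis unfolding almost_in_def by blast
qed

lemma block_le_star_almost_in:
  assumes "block_seq Y" "block_le_star Y X"
  shows "almost_in (bspan Y) X"
proof -
  obtain n where n: "bspan (block_tail Y n) \<subseteq> bspan X"
    using assms(2) by (auto simp: block_le_star_def block_le_def)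
  have "v \<in> bspan X" if "v \<in> bspan Y" "supp v \<subseteq> {n<..}" for v
    using in_span_block_tail[OF assms(1), of v n] that n unfolding bspan_def by auto
  then show ?thesis unfolding almost_in_def by blast
qed

section \<open>Infinite-dimensional subspaces and their tails\<close>

text \<open>A finite spanning set would bound all supports by some \<open>n\<close>, but
  \<open>X n\<close> has no support below \<open>n\<close>.\<close>

lemma infinite_dim_span_block:
  assumes X: "block_seq X"
  shows "infinite_dim_subspace (span (range X))"
  unfolding infinite_dim_subspace_def
proof (intro conjI notI)
  assume "\<exists>B. finite B \<and> span B = span (range X)"
  then obtain B where B: "finite B" "span B = span (range X)" by blast
  obtain n where n: "(\<Union>b\<in>B. supp b) \<subseteq> {..<n}"
    using B(1) finite_nat_iff_bounded[of "\<Union>b\<in>B. supp b"] by auto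
  have "X n \<in> span B" using B by (simp add: span_base)
  then have "supp (X n) \<subseteq> {..<n}"
    by (rule supp_span_subset) (use n in auto)
  moreover have "Min (supp (X n)) \<in> supp (X n)"
    using X by (simp add: block_seq_def)
  ultimately show False
    using block_seq_Min_ge[OF X, of n] by auto
qed simp

text \<open>The kernel of one coefficient functional has codimension at most one in
  \<open>V\<close>: a finite spanning set of it, together with one \<open>w\<close> outside it,
  would span \<open>V\<close>.\<close>

lemma infinite_dim_inter_coefficient_kernel:
  assumes V: "infinite_dim_subspace V"
  shows "infinite_dim_subspace (V \<inter> {v. supp v \<subseteq> - {i}})"
proof (rule ccontr)
  define K where "K = V \<inter> {v. supp v \<subseteq> - {i}}"
  assume "\<not> infinite_dim_subspace (V \<inter> {v. supp v \<subseteq> - {i}})"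
  moreover have sV: "subspace V" using V by (simp add: infinite_dim_subspace_def)
  moreover from sV have "subspace K"
    unfolding K_def by (intro subspace_inter subspace_supp_subset)
  ultimately obtain B where B: "finite B" "span B = K"
    by (auto simp: infinite_dim_subspace_def K_def)
  have "K \<noteq> V" using V B by (auto simp: infinite_dim_subspace_def)
  then obtain w where w: "w \<in> V" "i \<in> supp w" unfolding K_def by auto
  define c where "c v = representation (range e) v (e i)" for v
  have cw: "c w \<noteq> 0" using w by (simp add: supp_def c_def)
  have "V \<subseteq> span (insert w B)"
  proof
    fix v assume v: "v \<in> V"
    have "c (v - (c v / c w) *s w) = 0"
      using cw by (simp add: c_def representation_diff[OF basis_independent in_span_basis in_span_basis]
        representation_scale[OF basis_independent in_span_basis])
    then have "v - (c v / c w) *s w \<in> span B"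
      unfolding B(2) K_def using v w(1) sV
      by (auto simp: supp_def c_def subspace_diff subspace_scale)
    then show "v \<in> span (insert w B)" by (auto simp: span_insert)
  qed
  moreover have "B \<subseteq> V" using B(2) span_superset[of B] unfolding K_def by auto
  then have "span (insert w B) \<subseteq> V" using w sV by (intro span_minimal) auto
  ultimately show False
    using V B(1) unfolding infinite_dim_subspace_def by (metis finite_insert subset_antisym)
qed

lemma infinite_dim_inter_tail:
  assumes "infinite_dim_subspace V"
  shows "infinite_dim_subspace (V \<inter> {v. supp v \<subseteq> {n<..}})"
proof -
  have "infinite_dim_subspace (V \<inter> {v. supp v \<subseteq> {n..}})" for n
  proof (induction n)
    case 0
    then show ?case using assms by (simp add: atLeast_0)
  next
    case (Suc n)
    have "V \<inter> {v. supp v \<subseteq> {Suc n..}} = (V \<inter> {v. supp v \<subseteq> {n..}}) \<inter> {v. supp v \<subseteq> - {n}}"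
      by (auto simp: subset_iff Suc_le_eq order_le_less)
    then show ?case using infinite_dim_inter_coefficient_kernel[OF Suc] by simp
  qed
  from this[of "Suc n"] show ?thesis by (simp add: greaterThan_def atLeast_def Suc_le_eq)
qed

lemma infinite_dim_nonzero_tail:
  assumes "infinite_dim_subspace V"
  obtains v where "v \<in> V" "v \<noteq> 0" "supp v \<subseteq> {n<..}"
proof -
  have "V \<inter> {v. supp v \<subseteq> {n<..}} \<noteq> {0}"
    using infinite_dim_inter_tail[OF assms, of n] unfolding infinite_dim_subspace_def
    by (metis finite.emptyI span_empty)
  moreover have "0 \<in> V \<inter> {v. supp v \<subseteq> {n<..}}"
    using infinite_dim_inter_tail[OF assms, of n] unfolding infinite_dim_subspace_def
    by (auto dest: subspace_0)
  ultimately show ?thesis using that by blast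
qed

section \<open>Diagonalisation in (p)-filters\<close>

lemma block_filter_base:
  assumes "block_filter \<F>" "A \<in> \<F>"
  obtains X where "block_seq X" "bspan X \<in> \<F>" "bspan X \<subseteq> A"
  using assms that unfolding block_filter_def by blast

lemma block_filter_inter: "block_filter \<F> \<Longrightarrow> A \<in> \<F> \<Longrightarrow> B \<in> \<F> \<Longrightarrow> A \<inter> B \<in> \<F>"
  unfolding block_filter_def filter_on_E_def by blast

text \<open>Extends the (p)-property from sequences to countable families; intersecting with
  \<open>A\<close> afterwards is harmless because almost containment passes to subsets.\<close>

lemma p_filter_diagonal:
  assumes p: "p_filter \<F>" and I: "countable I"
    and Z: "\<And>i. i \<in> I \<Longrightarrow> block_seq (Z i) \<and> bspan (Z i) \<in> \<F>"
    and A: "A \<in> \<F>"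
  obtains X where "block_seq X" "bspan X \<in> \<F>" "bspan X \<subseteq> A"
    "\<And>i. i \<in> I \<Longrightarrow> almost_in (bspan X) (Z i)"
proof -
  have bf: "block_filter \<F>" using p by (simp add: p_filter_def)
  obtain X0 where X0: "block_seq X0" "bspan X0 \<in> \<F>" "bspan X0 \<subseteq> A"
    using block_filter_base[OF bf A] .
  \<comment> \<open>\<open>X0\<close> is the default for an empty family, which has nothing to
    enumerate.\<close>
  define Xs where "Xs n = (if I = {} then X0 else Z (from_nat_into I n))" for n
  have "block_seq (Xs n) \<and> bspan (Xs n) \<in> \<F>" for n
    using X0 Z from_nat_into[of I n] by (auto simp: Xs_def)
  then obtain X where X: "block_seq X" "bspan X \<in> \<F>" "\<And>n. block_le_star X (Xs n)"
    using p unfolding p_filter_def by meson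
  obtain X' where X': "block_seq X'" "bspan X' \<in> \<F>" "bspan X' \<subseteq> bspan X \<inter> A"
    using block_filter_base[OF bf block_filter_inter[OF bf X(2) A]] .
  have "almost_in (bspan X') (Z i)" if i: "i \<in> I" for i
  proof -
    obtain n where "from_nat_into I n = i"
      using from_nat_into_surj[OF I i] by blast
    then have "Xs n = Z i" using i by (auto simp: Xs_def)
    then show ?thesis
      using almost_in_subset[OF block_le_star_almost_in[OF X(1) X(3)[of n]]] X'(3) by auto
  qed
  then show ?thesis using that X' by blast
qed

section \<open>Strategies that preserve an invariant\<close>

text \<open>Positions are lists of II's answers, the most recent one first.\<close>

lemma strategy_II_of_invariant:
  assumes base: "P []"
    and step: "\<And>s Y. P s \<Longrightarrow> Y \<in> M \<Longrightarrow>
      \<exists>y\<in>bspan Y. (s \<noteq> [] \<longrightarrow> block_before (hd s) y) \<and> P (y # s)"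
  obtains \<beta> where "strategy_II M \<beta>"
    "\<And>y k. outcome_of M \<beta> y \<Longrightarrow> P (rev (map y [0..<k]))"
proof -
  obtain pick where pick: "\<And>s Y. P s \<Longrightarrow> Y \<in> M \<Longrightarrow> pick s Y \<in> bspan Y \<and>
      (s \<noteq> [] \<longrightarrow> block_before (hd s) (pick s Y)) \<and> P (pick s Y # s)"
    using step by metis
  \<comment> \<open>\<open>R\<close> replays the moves of I and collects the answers of II;
    \<open>\<beta>\<close> returns the latest one.\<close>
  define R where "R Ys = fold (\<lambda>Y s. pick s Y # s) Ys []" for Ys
  define \<beta> where "\<beta> Ys = hd (R Ys)" for Ys
  have R_snoc: "R (Ys @ [Y]) = pick (R Ys) Y # R Ys" for Ys Y
    by (simp add: R_def)
  have PR: "P (R Ys)" if "set Ys \<subseteq> M" for Ys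
    using that by (induction Ys rule: rev_induct) (auto simp: R_snoc pick, simp add: R_def base)
  have R_Nil: "R Ys = [] \<longleftrightarrow> Ys = []" for Ys
    by (cases Ys rule: rev_cases) (auto simp: R_snoc, simp add: R_def)
  have "strategy_II M \<beta>"
    unfolding strategy_II_def \<beta>_def using pick PR by (auto simp: R_snoc R_Nil)
  moreover have "P (rev (map y [0..<k]))" if "outcome_of M \<beta> y" for y k
  proof -
    obtain Y where Y: "\<And>k. Y k \<in> M" "\<And>k. y k = \<beta> (map Y [0..<Suc k])"
      using \<open>outcome_of M \<beta> y\<close> unfolding outcome_of_def by blast
    have "R (map Y [0..<k]) = rev (map y [0..<k])"
    proof (induction k)
      case (Suc k)
      have "y k = pick (R (map Y [0..<k])) (Y k)"
        using Y(2)[of k] by (simp add: \<beta>_def R_snoc)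
      then show ?case using Suc by (simp add: R_snoc)
    qed (simp add: R_def)
    moreover have "set (map Y [0..<k]) \<subseteq> M" using Y(1) by auto
    ultimately show ?thesis using PR by metis
  qed
  ultimately show ?thesis using that by blast
qed

section \<open>From +-strategic to strategic and full\<close>

lemma plus_strategic_imp_strategic:
  assumes "plus_strategic \<F>"
  shows "strategic \<F>"
  unfolding strategic_def
proof (intro allI impI, elim conjE)
  fix X \<alpha>
  assume X: "block_seq X" "bspan X \<in> \<F>" and \<alpha>: "strategy_II (gowers_moves X) \<alpha>"
  have sub: "restricted_gowers_moves \<F> X \<subseteq> gowers_moves X"
    by (auto simp: restricted_gowers_moves_def)
  then have "strategy_II (restricted_gowers_moves \<F> X) \<alpha>"
    using \<alpha> unfolding strategy_II_def by (meson subsetD subset_trans)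
  then obtain Y where "outcome_of (restricted_gowers_moves \<F> X) \<alpha> Y" "bspan Y \<in> \<F>"
    using assms X unfolding plus_strategic_def by blast
  then show "\<exists>Y. outcome_of (gowers_moves X) \<alpha> Y \<and> bspan Y \<in> \<F>"
    using sub unfolding outcome_of_def by blast
qed

text \<open>Only almost containment is asked of \<open>V\<close>, since the vectors of
  \<open>s\<close>, chosen earlier, need not lie in the span of \<open>X\<close>.\<close>

definition alive :: "'v set set \<Rightarrow> 'v set \<Rightarrow> 'v list \<Rightarrow> bool" where
  "alive \<F> D s \<longleftrightarrow> (\<forall>X. block_seq X \<and> bspan X \<in> \<F> \<longrightarrow>
     (\<exists>V. infinite_dim_subspace V \<and> set s \<subseteq> V \<and> V - {0} \<subseteq> D \<and> almost_in V X))"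

text \<open>Suppose each admissible answer \<open>y\<close> is refuted by some \<open>Z y\<close>,
  and let \<open>X\<close> be almost below all of these. A \<open>V\<close> showing that
  \<open>s\<close> is alive at \<open>X\<close> contains an admissible \<open>y\<close>, and this
  same \<open>V\<close> contradicts the choice of \<open>Z y\<close>.\<close>

lemma alive_extend:
  assumes p: "p_filter \<F>" and s: "alive \<F> D s"
    and Y: "block_seq Y" "bspan Y \<in> \<F>"
  shows "\<exists>y\<in>bspan Y. (s \<noteq> [] \<longrightarrow> block_before (hd s) y) \<and> alive \<F> D (y # s)"
proof (rule ccontr)
  define N where "N = {y \<in> bspan Y. s \<noteq> [] \<longrightarrow> block_before (hd s) y}"
  assume "\<not> ?thesis"
  then have "\<forall>y\<in>N. \<exists>X. block_seq X \<and> bspan X \<in> \<F> \<and>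
      \<not> (\<exists>V. infinite_dim_subspace V \<and> set (y # s) \<subseteq> V \<and> V - {0} \<subseteq> D \<and> almost_in V X)"
    unfolding N_def alive_def by blast
  then obtain Z where Z: "\<And>y. y \<in> N \<Longrightarrow> block_seq (Z y) \<and> bspan (Z y) \<in> \<F>"
    and none: "\<And>y V. y \<in> N \<Longrightarrow> infinite_dim_subspace V \<Longrightarrow> set (y # s) \<subseteq> V \<Longrightarrow>
      V - {0} \<subseteq> D \<Longrightarrow> \<not> almost_in V (Z y)"
    by metis
  have N: "countable N" by (rule countable_subset[OF subset_UNIV countable_vectors])
  obtain X where X: "block_seq X" "bspan X \<in> \<F>" "bspan X \<subseteq> bspan Y"
    "\<And>y. y \<in> N \<Longrightarrow> almost_in (bspan X) (Z y)"
    by (rule p_filter_diagonal[where Z = Z, OF p N _ Y(2)]) (use Z in blast)+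
  obtain V where V: "infinite_dim_subspace V" "set s \<subseteq> V" "V - {0} \<subseteq> D" "almost_in V X"
    using s X(1,2) unfolding alive_def by blast
  obtain n where n: "\<forall>v\<in>V. v \<noteq> 0 \<longrightarrow> supp v \<subseteq> {n<..} \<longrightarrow> v \<in> bspan X"
    using V(4) unfolding almost_in_def by blast
  \<comment> \<open>Support above \<open>n\<close> puts \<open>y\<close> into
    \<open>bspan X\<close>; the other bound makes it a legal successor of \<open>hd s\<close>. For
    empty \<open>s\<close> the second bound is arbitrary but harmless.\<close>
  obtain y where y: "y \<in> V" "y \<noteq> 0" "supp y \<subseteq> {max n (Max (supp (hd s)))<..}"
    using infinite_dim_nonzero_tail[OF V(1)] .
  then have "y \<in> bspan X" using n by fastforce
  moreover have "block_before (hd s) y"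
    using Min_supp_gt[OF y(2,3)] by (simp add: block_before_def)
  ultimately have "y \<in> N" using X(3) by (auto simp: N_def)
  then show False
    using none[of y V] V y(1) almost_in_trans[OF V(4) X(4)] by auto
qed

lemma plus_strategic_imp_full:
  assumes p: "p_filter \<F>" and plus: "plus_strategic \<F>"
  shows "full \<F>"
  unfolding full_def
proof (intro allI impI)
  fix D assume D: "filter_dense \<F> D"
  have bf: "block_filter \<F>" using p by (simp add: p_filter_def)
  then have "UNIV - {0} \<in> \<F>" by (simp add: block_filter_def filter_on_E_def)
  then obtain X where X: "block_seq X" "bspan X \<in> \<F>"
    using block_filter_base[OF bf] by blast
  have base: "alive \<F> D []"
    unfolding alive_def
  proof (intro allI impI)
    fix X assume "block_seq X \<and> bspan X \<in> \<F>"
    then obtain V where "infinite_dim_subspace V" "V \<subseteq> bspan X \<union> {0}" "V - {0} \<subseteq> D"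
      using D unfolding filter_dense_def by blast
    then show "\<exists>V. infinite_dim_subspace V \<and> set [] \<subseteq> V \<and> V - {0} \<subseteq> D \<and> almost_in V X"
      unfolding almost_in_def by (intro exI[of _ V]) auto
  qed
  obtain \<beta> where \<beta>: "strategy_II (restricted_gowers_moves \<F> X) \<beta>"
    and inv: "\<And>y k. outcome_of (restricted_gowers_moves \<F> X) \<beta> y \<Longrightarrow>
      alive \<F> D (rev (map y [0..<k]))"
    using strategy_II_of_invariant[of "alive \<F> D" "restricted_gowers_moves \<F> X"] base
      alive_extend[OF p] unfolding restricted_gowers_moves_def gowers_moves_def by blast
  obtain y where y: "outcome_of (restricted_gowers_moves \<F> X) \<beta> y" "bspan y \<in> \<F>"
    using plus X \<beta> unfolding plus_strategic_def by blast
  \<comment> \<open>Each \<open>v\<close> uses only finitely many terms of \<open>y\<close>, so the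
    subspace attached to one alive initial segment already contains it.\<close>
  have "bspan y \<subseteq> D - {0}"
  proof
    fix v assume v: "v \<in> bspan y"
    then have "v \<in> span (range y)" by (simp add: bspan_def)
    then obtain k where k: "v \<in> span (y ` {..<k})"
      by (rule span_range_initial)
    obtain V where V: "infinite_dim_subspace V" "set (rev (map y [0..<k])) \<subseteq> V" "V - {0} \<subseteq> D"
      using inv[OF y(1), of k] X unfolding alive_def by blast
    have "y ` {..<k} \<subseteq> V" using V(2) by (simp add: atLeast0LessThan)
    then have "v \<in> V"
      using k V(1) span_minimal unfolding infinite_dim_subspace_def by blast
    then show "v \<in> D - {0}" using v V(3) by (auto simp: bspan_def)
  qed
  then show "D - {0} \<in> \<F>"
    using y(2) bf unfolding block_filter_def filter_on_E_def by blast
qed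

section \<open>From strategic and full to +-strategic\<close>

text \<open>Otherwise the set \<open>D\<close> of vectors that are not possible answers is dense, so
  by fullness it includes the span of a legal move \<open>W\<close>. The answer to \<open>W\<close>
  lies in that span, hence in \<open>D\<close>, which is absurd.\<close>

lemma full_answers_meet_subspaces:
  assumes bf: "block_filter \<F>" and full: "full \<F>" and X: "bspan X \<in> \<F>"
    and \<alpha>: "strategy_II (restricted_gowers_moves \<F> X) \<alpha>"
    and h: "set h \<subseteq> restricted_gowers_moves \<F> X"
  shows "\<exists>Z. block_seq Z \<and> bspan Z \<in> \<F> \<and>
    (\<forall>V. infinite_dim_subspace V \<and> V \<subseteq> bspan Z \<union> {0} \<longrightarrow>
      (\<exists>Y\<in>restricted_gowers_moves \<F> X. \<alpha> (h @ [Y]) \<in> V - {0}))"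
proof (rule ccontr)
  define D where "D = - {\<alpha> (h @ [Y]) | Y. Y \<in> restricted_gowers_moves \<F> X}"
  assume contra: "\<not> ?thesis"
  have "filter_dense \<F> D"
    unfolding filter_dense_def
  proof (intro allI impI)
    fix Z assume "block_seq Z \<and> bspan Z \<in> \<F>"
    then obtain V where "infinite_dim_subspace V" "V \<subseteq> bspan Z \<union> {0}"
      "\<And>Y. Y \<in> restricted_gowers_moves \<F> X \<Longrightarrow> \<alpha> (h @ [Y]) \<notin> V - {0}"
      using contra by blast
    then show "\<exists>V. infinite_dim_subspace V \<and> V \<subseteq> bspan Z \<union> {0} \<and> V - {0} \<subseteq> D"
      unfolding D_def by (intro exI[of _ V]) auto
  qed
  then have "D - {0} \<in> \<F>" using full by (simp add: full_def)
  then obtain W where W: "block_seq W" "bspan W \<in> \<F>" "bspan W \<subseteq> (D - {0}) \<inter> bspan X"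
    using block_filter_base[OF bf block_filter_inter[OF bf _ X]] by blast
  then have WM: "W \<in> restricted_gowers_moves \<F> X"
    by (auto simp: restricted_gowers_moves_def gowers_moves_def block_le_def)
  then have "\<alpha> (h @ [W]) \<in> bspan W"
    using \<alpha> h unfolding strategy_II_def by blast
  then have "\<alpha> (h @ [W]) \<in> D" using W by blast
  then show False using WM unfolding D_def by blast
qed

lemma strategic_full_imp_plus_strategic:
  assumes p: "p_filter \<F>" and strategic: "strategic \<F>" and full: "full \<F>"
  shows "plus_strategic \<F>"
  unfolding plus_strategic_def
proof (intro allI impI, elim conjE)
  fix X \<alpha>
  define M where "M = restricted_gowers_moves \<F> X"
  assume X: "block_seq X" "bspan X \<in> \<F>" and "strategy_II (restricted_gowers_moves \<F> X) \<alpha>"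
  then have \<alpha>: "strategy_II M \<alpha>" by (simp add: M_def)
  have bf: "block_filter \<F>" using p by (simp add: p_filter_def)
  \<comment> \<open>\<open>move\<close> fixes one move of I provoking the answer \<open>y\<close>,
    and \<open>H\<close> rebuilds a whole history from the answers alone. Histories are thus indexed
    by finite lists of vectors, a countable set.\<close>
  define move where "move h y = (SOME Y. Y \<in> M \<and> \<alpha> (h @ [Y]) = y)" for h y
  define H where "H t = foldr (\<lambda>y h. h @ [move h y]) t []" for t
  have H_simps: "H [] = []" "H (y # t) = H t @ [move (H t) y]" for y t
    by (simp_all add: H_def)
  \<comment> \<open>These are the positions at which the choices made by \<open>H\<close> are legal
    and the last answer is reproduced.\<close>
  define ok where "ok t \<longleftrightarrow> set (H t) \<subseteq> M \<and> (t \<noteq> [] \<longrightarrow> \<alpha> (H t) = hd t)" for t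
  \<comment> \<open>The chosen move may differ from \<open>Y\<close>, but it provokes the same
    answer; \<open>Y\<close> itself shows that a choice exists.\<close>
  have ok_Cons: "ok (\<alpha> (H t @ [Y]) # t)" if "ok t" "Y \<in> M" for t Y
    using someI[of "\<lambda>Y'. Y' \<in> M \<and> \<alpha> (H t @ [Y']) = \<alpha> (H t @ [Y])" Y] that
    unfolding ok_def H_simps move_def[symmetric] by auto
  have "\<forall>t\<in>{t. ok t}. \<exists>Z. block_seq Z \<and> bspan Z \<in> \<F> \<and>
    (\<forall>V. infinite_dim_subspace V \<and> V \<subseteq> bspan Z \<union> {0} \<longrightarrow>
      (\<exists>Y\<in>M. \<alpha> (H t @ [Y]) \<in> V - {0}))"
    using full_answers_meet_subspaces[OF bf full X(2) \<alpha>[unfolded M_def]]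
    unfolding ok_def M_def by blast
  then obtain Z where Z: "\<And>t. t \<in> {t. ok t} \<Longrightarrow> block_seq (Z t) \<and> bspan (Z t) \<in> \<F>"
    and meets: "\<And>t V. ok t \<Longrightarrow> infinite_dim_subspace V \<Longrightarrow> V \<subseteq> bspan (Z t) \<union> {0} \<Longrightarrow>
      \<exists>Y\<in>M. \<alpha> (H t @ [Y]) \<in> V - {0}"
    by (metis mem_Collect_eq)
  have "countable {t. ok t}"
    using countable_lists[OF countable_vectors] by (rule countable_subset[rotated]) auto
  from p_filter_diagonal[where Z = Z, OF p this Z X(2)]
  obtain W where W: "block_seq W" "bspan W \<in> \<F>"
    and WZ: "\<And>t. t \<in> {t. ok t} \<Longrightarrow> almost_in (bspan W) (Z t)"
    by metis
  have step: "\<exists>y\<in>bspan Y. (t \<noteq> [] \<longrightarrow> block_before (hd t) y) \<and> ok (y # t)"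
    if t: "ok t" and Y: "Y \<in> gowers_moves W" for t Y
  proof -
    have Y: "block_seq Y" "bspan Y \<subseteq> bspan W"
      using Y by (auto simp: gowers_moves_def block_le_def)
    obtain n where n: "\<forall>v\<in>bspan Y. v \<noteq> 0 \<longrightarrow> supp v \<subseteq> {n<..} \<longrightarrow> v \<in> bspan (Z t)"
      using almost_in_subset[OF WZ[of t] Y(2)] t unfolding almost_in_def by blast
    \<comment> \<open>Cutting off at \<open>n\<close> moves the span of \<open>Y\<close> inside that
      of \<open>Z t\<close>, where every infinite-dimensional subspace contains an answer of
      \<open>\<alpha>\<close>. That answer is then a legal reply to \<open>Y\<close>.\<close>
    define V where "V = span (range Y) \<inter> {v. supp v \<subseteq> {n<..}}"
    have "infinite_dim_subspace V"
      unfolding V_def by (intro infinite_dim_inter_tail infinite_dim_span_block Y)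
    moreover have "V \<subseteq> bspan (Z t) \<union> {0}"
      using n unfolding V_def bspan_def by auto
    ultimately obtain Y' where Y': "Y' \<in> M" "\<alpha> (H t @ [Y']) \<in> V - {0}"
      using meets[OF t] by blast
    have "H t = [] \<longleftrightarrow> t = []" by (cases t) (auto simp: H_simps)
    then have "t \<noteq> [] \<longrightarrow> block_before (hd t) (\<alpha> (H t @ [Y']))"
      using \<alpha> Y'(1) t unfolding strategy_II_def ok_def by metis
    moreover have "\<alpha> (H t @ [Y']) \<in> bspan Y"
      using Y'(2) by (auto simp: V_def bspan_def)
    ultimately show ?thesis using ok_Cons[OF t Y'(1)] by blast
  qed
  have "ok []" by (simp add: ok_def H_simps)
  then obtain \<beta> where \<beta>: "strategy_II (gowers_moves W) \<beta>"
    and inv: "\<And>y k. outcome_of (gowers_moves W) \<beta> y \<Longrightarrow> ok (rev (map y [0..<k]))"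
    using strategy_II_of_invariant[of ok "gowers_moves W"] step by blast
  obtain y where y: "outcome_of (gowers_moves W) \<beta> y" "bspan y \<in> \<F>"
    using strategic W \<beta> unfolding strategic_def by blast
  \<comment> \<open>These moves of I in the restricted game make \<open>\<alpha>\<close> produce
    \<open>y\<close>. Since \<open>ok\<close> controls only the last answer, it is applied to every
    initial segment.\<close>
  define Y where "Y k = move (H (rev (map y [0..<k]))) (y k)" for k
  have HY: "H (rev (map y [0..<k])) = map Y [0..<k]" for k
    by (induction k) (simp_all add: H_simps Y_def)
  have okY: "ok (rev (map y [0..<k]))" for k using inv[OF y(1)] .
  have "Y k \<in> M \<and> y k = \<alpha> (map Y [0..<Suc k])" for k
    using okY[of "Suc k"] unfolding ok_def HY by auto
  then have "outcome_of M \<alpha> y" unfolding outcome_of_def by blast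
  then show "\<exists>Y. outcome_of (restricted_gowers_moves \<F> X) \<alpha> Y \<and> bspan Y \<in> \<F>"
    using y(2) unfolding M_def by blast
qed

end

theorem theorem5p6:
  fixes scale :: "'f::{field,countable} \<Rightarrow> 'v::ab_group_add \<Rightarrow> 'v"
    and e :: "nat \<Rightarrow> 'v"
    and \<F> :: "'v set set"
  assumes "block_space scale e"
    and "block_space.p_filter scale e \<F>"
  shows "block_space.plus_strategic scale e \<F> \<longleftrightarrow>
    block_space.strategic scale e \<F> \<and> block_space.full scale e \<F>"
proof -
  interpret block_space scale e by (rule assms(1))
  show ?thesis
    using assms(2) plus_strategic_imp_strategic plus_strategic_imp_full
      strategic_full_imp_plus_strategic by blast
qed

end
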